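(* Let $R$ be a commutative ring, let $G,H$ be directed graphs and let $f,g\colon G\to H$ be maps of directed graphs. If there is a long homotopy from $f$ to $g$ (written $f\rightsquigarrow g$), then the chain maps $f_\ast,g_\ast\colon \mathrm{RC}_\ast(G)\to \mathrm{RC}_\ast(H)$ are chain-homotopic, and consequently the maps $f_\ast,g_\ast\colon \mathrm{RH}_\ast(G)\to\mathrm{RH}_\ast(H)$ are equal. The relevant chain homotopy is given by the (degree $+1$) map $s_\ast\colon \mathrm{RC}_\ast(G)\to\mathrm{RC}_\ast(H)$ specified on generators by $$(x_0,\ldots,x_i)\longmapsto \sum_{j=0}^i (-1)^{j+1}\,(f(x_0),\ldots,f(x_j),g(x_j),\ldots,g(x_i)),$$ where any tuple in which adjacent entries coincide is omitted. It follows that long-homotopy equivalences induce isomorphisms on reachability homology.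
   Context: A directed graph $G$ is a set $V(G)$ of vertices with a set $E(G)\subseteq V(G)\times V(G)$ of directed edges. A map of directed graphs $f\colon G\to H$ is a function $f\colon V(G)\to V(H)$ such that for every edge $(u,v)\in E(G)$ either $f(u)=f(v)$ or $(f(u),f(v))\in E(H)$ (or both). A directed path in $G$ from $u$ to $v$ is a tuple $(v_0,\ldots,v_k)$ of vertices with $v_0=u$, $v_k=v$ and, for each $0\le i<k$, $v_i=v_{i+1}$ or $(v_i,v_{i+1})\in E(G)$. Reachability complex: $\mathrm{RC}_\ast(G)$ is the chain complex of $R$-modules which in degree $k$ is freely generated by tuples $(v_0,\ldots,v_k)$ of vertices of $G$ such that adjacent entries are distinct and, for each $1\le j\le k$, there is a directed path in $G$ from $v_{j-1}$ to $v_j$. The differential is $\partial(v_0,\ldots,v_k)=\sum_{j=0}^k(-1)^j(v_0,\ldots,\widehat{v_j},\ldots,v_k)$, where any term in which adjacent entries coincide is omitted. Reachability homology is $\mathrm{RH}_\ast(G)=H_\ast(\mathrm{RC}_\ast(G))$. A map $f\colon G\to H$ induces a chain map $f_\ast\colon\mathrm{RC}_\ast(G)\to\mathrm{RC}_\ast(H)$ sending $(v_0,\ldots,v_k)$ to $(f(v_0),\ldots,f(v_k))$ if adjacent entries of the latter are distinct and to $0$ otherwise; the induced map on homology is also denoted $f_\ast$. Long homotopy: for maps $f,g\colon G\to H$, there is a long homotopy from $f$ to $g$, written $f\rightsquigarrow g$, if for each vertex $v$ of $G$ there is a directed path in $H$ from $f(v)$ to $g(v)$. A map $f\colon G\to H$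 is a long-homotopy equivalence if there is a map $g\colon H\to G$ such that $f\circ g$ is related to $\mathrm{Id}_H$ by a zig-zag of long homotopies and $g\circ f$ is related to $\mathrm{Id}_G$ by a zig-zag of long homotopies. *)

theory Defs
  imports "Graph_Theory.Pair_Digraph" "HOL-Library.Poly_Mapping"
begin

text \<open>
  A directed graph is a \<^typ>\<open>'v pair_pre_digraph\<close> satisfying \<^const>\<open>pair_wf_digraph\<close>, that is, with
  its edges contained in the square of the vertex set; the graph may be infinite and may have loops.
  Maps between graphs are represented by total functions, of which only the values on vertices
  matter.
\<close>

definition digraph_map :: "'a pair_pre_digraph \<Rightarrow> 'b pair_pre_digraph \<Rightarrow> ('a \<Rightarrow> 'b) \<Rightarrow> bool" where
  "digraph_map G H f \<longleftrightarrow>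
     f ` pverts G \<subseteq> pverts H \<and>
     (\<forall>(u, v) \<in> parcs G. f u = f v \<or> (f u, f v) \<in> parcs H)"

definition directed_path :: "'v pair_pre_digraph \<Rightarrow> 'v \<Rightarrow> 'v list \<Rightarrow> 'v \<Rightarrow> bool" where
  "directed_path G u p v \<longleftrightarrow>
     p \<noteq> [] \<and> hd p = u \<and> last p = v \<and> set p \<subseteq> pverts G \<and>
     successively (\<lambda>x y. x = y \<or> (x, y) \<in> parcs G) p"

definition has_path :: "'v pair_pre_digraph \<Rightarrow> 'v \<Rightarrow> 'v \<Rightarrow> bool" where
  "has_path G u v \<longleftrightarrow> (\<exists>p. directed_path G u p v)"

definition long_homotopy ::
  "'a pair_pre_digraph \<Rightarrow> 'b pair_pre_digraph \<Rightarrow> ('a \<Rightarrow> 'b) \<Rightarrow> ('a \<Rightarrow> 'b) \<Rightarrow> bool" where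
  "long_homotopy G H f g \<longleftrightarrow>
     digraph_map G H f \<and> digraph_map G H g \<and> (\<forall>v \<in> pverts G. has_path H (f v) (g v))"

definition long_homotopy_zigzag ::
  "'a pair_pre_digraph \<Rightarrow> 'b pair_pre_digraph \<Rightarrow> ('a \<Rightarrow> 'b) \<Rightarrow> ('a \<Rightarrow> 'b) \<Rightarrow> bool" where
  "long_homotopy_zigzag G H = equivclp (long_homotopy G H)"

definition long_homotopy_equivalence ::
  "'a pair_pre_digraph \<Rightarrow> 'b pair_pre_digraph \<Rightarrow> ('a \<Rightarrow> 'b) \<Rightarrow> bool" where
  "long_homotopy_equivalence G H f \<longleftrightarrow>
     digraph_map G H f \<and>
     (\<exists>g. digraph_map H G g \<and>
          long_homotopy_zigzag H H (f \<circ> g) id \<and>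
          long_homotopy_zigzag G G (g \<circ> f) id)"

text \<open>
  The sort \<open>{comm_ring, comm_monoid_mult}\<close> is that of commutative rings with unit. It is used
  instead of \<^class>\<open>comm_ring_1\<close>, which excludes the zero ring.

  The tuple $(v_0,\ldots,v_k)$ is the list of length $k+1$ with these entries, and chains are finitely
  supported functions on lists.
\<close>

type_synonym ('v, 'r) chain = "'v list \<Rightarrow>\<^sub>0 'r"

definition scale ::
  "'r::{comm_ring, comm_monoid_mult} \<Rightarrow> ('v, 'r) chain \<Rightarrow> ('v, 'r) chain" where
  "scale a c = Poly_Mapping.map ((*) a) c"

text \<open>A tuple regarded as a chain, with the convention that it is omitted if adjacent entries coincide.\<close>

definition tup :: "'v list \<Rightarrow> ('v, 'r::{comm_ring, comm_monoid_mult}) chain" where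
  "tup xs = (if distinct_adj xs then Poly_Mapping.single xs 1 else 0)"

definition lin_ext ::
  "('a list \<Rightarrow> ('b, 'r::{comm_ring, comm_monoid_mult}) chain) \<Rightarrow> ('a, 'r) chain \<Rightarrow> ('b, 'r) chain" where
  "lin_ext \<phi> c = (\<Sum>xs \<in> Poly_Mapping.keys c. scale (Poly_Mapping.lookup c xs) (\<phi> xs))"

definition rc_gens :: "'v pair_pre_digraph \<Rightarrow> nat \<Rightarrow> 'v list set" where
  "rc_gens G k =
     {xs. length xs = Suc k \<and> set xs \<subseteq> pverts G \<and> distinct_adj xs \<and> successively (has_path G) xs}"

definition RC ::
  "'v pair_pre_digraph \<Rightarrow> nat \<Rightarrow> ('v, 'r::{comm_ring, comm_monoid_mult}) chain set" where
  "RC G k = {c. Poly_Mapping.keys c \<subseteq> rc_gens G k}"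

text \<open>
  The differential is given on all degrees simultaneously, the degree of a tuple being visible from
  its length. There is nothing in degree $-1$, so it vanishes on tuples of length one.
\<close>

definition boundary ::
  "('v, 'r::{comm_ring, comm_monoid_mult}) chain \<Rightarrow> ('v, 'r) chain" where
  "boundary = lin_ext (\<lambda>xs.
     if length xs \<le> 1 then 0
     else (\<Sum>j<length xs. scale ((- 1) ^ j) (tup (take j xs @ drop (Suc j) xs))))"

definition induced ::
  "('a \<Rightarrow> 'b) \<Rightarrow> ('a, 'r::{comm_ring, comm_monoid_mult}) chain \<Rightarrow> ('b, 'r) chain" where
  "induced f = lin_ext (\<lambda>xs. tup (map f xs))"

definition linear_between ::
  "('a, 'r::{comm_ring, comm_monoid_mult}) chain set \<Rightarrow> ('b, 'r) chain set \<Rightarrow>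
   (('a, 'r) chain \<Rightarrow> ('b, 'r) chain) \<Rightarrow> bool" where
  "linear_between S T F \<longleftrightarrow>
     F ` S \<subseteq> T \<and>
     (\<forall>x \<in> S. \<forall>y \<in> S. F (x + y) = F x + F y) \<and>
     (\<forall>a. \<forall>x \<in> S. F (scale a x) = scale a (F x))"

definition rc_chain_map ::
  "'a pair_pre_digraph \<Rightarrow> 'b pair_pre_digraph \<Rightarrow>
   (('a, 'r::{comm_ring, comm_monoid_mult}) chain \<Rightarrow> ('b, 'r) chain) \<Rightarrow> bool" where
  "rc_chain_map G H \<phi> \<longleftrightarrow>
     (\<forall>k. linear_between (RC G k) (RC H k) \<phi> \<and>
          (\<forall>c \<in> RC G k. boundary (\<phi> c) = \<phi> (boundary c)))"

text \<open>
  The sign convention is $\partial s + s\partial = \phi - \psi$ for a chain homotopy $s$ from $\phi$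
  to $\psi$.
\<close>

definition rc_chain_homotopy ::
  "'a pair_pre_digraph \<Rightarrow> 'b pair_pre_digraph \<Rightarrow>
   (('a, 'r::{comm_ring, comm_monoid_mult}) chain \<Rightarrow> ('b, 'r) chain) \<Rightarrow>
   (('a, 'r) chain \<Rightarrow> ('b, 'r) chain) \<Rightarrow> (('a, 'r) chain \<Rightarrow> ('b, 'r) chain) \<Rightarrow> bool" where
  "rc_chain_homotopy G H \<phi> \<psi> s \<longleftrightarrow>
     rc_chain_map G H \<phi> \<and> rc_chain_map G H \<psi> \<and>
     (\<forall>k. linear_between (RC G k) (RC H (Suc k)) s \<and>
          (\<forall>c \<in> RC G k. boundary (s c) + s (boundary c) = \<phi> c - \<psi> c))"

definition rc_chain_homotopic ::
  "'a pair_pre_digraph \<Rightarrow> 'b pair_pre_digraph \<Rightarrow>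
   (('a, 'r::{comm_ring, comm_monoid_mult}) chain \<Rightarrow> ('b, 'r) chain) \<Rightarrow>
   (('a, 'r) chain \<Rightarrow> ('b, 'r) chain) \<Rightarrow> bool" where
  "rc_chain_homotopic G H \<phi> \<psi> \<longleftrightarrow> (\<exists>s. rc_chain_homotopy G H \<phi> \<psi> s)"

definition homotopy_op ::
  "('a \<Rightarrow> 'b) \<Rightarrow> ('a \<Rightarrow> 'b) \<Rightarrow>
   ('a, 'r::{comm_ring, comm_monoid_mult}) chain \<Rightarrow> ('b, 'r) chain" where
  "homotopy_op f g = lin_ext (\<lambda>xs.
     \<Sum>j<length xs. scale ((- 1) ^ (j + 1)) (tup (map f (take (Suc j) xs) @ map g (drop j xs))))"

definition rc_cycles ::
  "'v pair_pre_digraph \<Rightarrow> nat \<Rightarrow> ('v, 'r::{comm_ring, comm_monoid_mult}) chain set" where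
  "rc_cycles G k = {c \<in> RC G k. boundary c = 0}"

definition rc_boundaries ::
  "'v pair_pre_digraph \<Rightarrow> nat \<Rightarrow> ('v, 'r::{comm_ring, comm_monoid_mult}) chain set" where
  "rc_boundaries G k = boundary ` RC G (Suc k)"

definition homologous ::
  "'v pair_pre_digraph \<Rightarrow> nat \<Rightarrow> ('v, 'r::{comm_ring, comm_monoid_mult}) chain rel" where
  "homologous G k =
     {(x, y). x \<in> rc_cycles G k \<and> y \<in> rc_cycles G k \<and> x - y \<in> rc_boundaries G k}"

definition RH ::
  "'v pair_pre_digraph \<Rightarrow> nat \<Rightarrow> ('v, 'r::{comm_ring, comm_monoid_mult}) chain set set" where
  "RH G k = rc_cycles G k // homologous G k"

text \<open>
  The module structure on homology and the maps induced on it are defined by operating on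
  representatives: each union below is over all choices of representatives, all of which
  give the same class.
\<close>

definition rh_add ::
  "'v pair_pre_digraph \<Rightarrow> nat \<Rightarrow> ('v, 'r::{comm_ring, comm_monoid_mult}) chain set \<Rightarrow>
   ('v, 'r) chain set \<Rightarrow> ('v, 'r) chain set" where
  "rh_add G k X Y = (\<Union>x \<in> X. \<Union>y \<in> Y. homologous G k `` {x + y})"

definition rh_scale ::
  "'v pair_pre_digraph \<Rightarrow> nat \<Rightarrow> 'r::{comm_ring, comm_monoid_mult} \<Rightarrow>
   ('v, 'r) chain set \<Rightarrow> ('v, 'r) chain set" where
  "rh_scale G k a X = (\<Union>x \<in> X. homologous G k `` {scale a x})"

definition rh_map ::
  "'b pair_pre_digraph \<Rightarrow> nat \<Rightarrow>
   (('a, 'r::{comm_ring, comm_monoid_mult}) chain \<Rightarrow> ('b, 'r) chain) \<Rightarrow>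
   ('a, 'r) chain set \<Rightarrow> ('b, 'r) chain set" where
  "rh_map H k \<phi> X = (\<Union>x \<in> X. homologous H k `` {\<phi> x})"

definition rh_iso ::
  "'a pair_pre_digraph \<Rightarrow> 'b pair_pre_digraph \<Rightarrow> nat \<Rightarrow>
   (('a, 'r::{comm_ring, comm_monoid_mult}) chain set \<Rightarrow> ('b, 'r) chain set) \<Rightarrow> bool" where
  "rh_iso G H k F \<longleftrightarrow>
     bij_betw F (RH G k) (RH H k) \<and>
     (\<forall>X \<in> RH G k. \<forall>Y \<in> RH G k. F (rh_add G k X Y) = rh_add H k (F X) (F Y)) \<and>
     (\<forall>a. \<forall>X \<in> RH G k. F (rh_scale G k a X) = rh_scale H k a (F X))"

end

theory Submission
  imports Defs
begin

text \<open>
  Everything is computed in the augmented complex, where the empty tuple is a generator and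
  where prefixing a vertex \<open>x\<close> is a linear operator \<open>cone x\<close>. The differential satisfies
  $\partial(\mathrm{cone}_x\,c) = c - \mathrm{cone}_x(\partial c)$ and the homotopy
  $s(\mathrm{cone}_x\,c) = -\mathrm{cone}_{f x}\mathrm{cone}_{g x}(g_*c) - \mathrm{cone}_{f x}(s\,c)$;
  with these recursions the identity $\partial s + s\partial = f_* - g_*$ is an induction on the
  length of the tuple. As $\mathrm{cone}_x\mathrm{cone}_x = 0$, the recursions also show that the
  formulas for $\partial$ and $s$ vanish on tuples with coinciding adjacent entries, so that omitting
  such tuples is harmless.
\<close>

section \<open>Linear extension\<close>

lemma lookup_scale [simp]: "Poly_Mapping.lookup (scale a c) xs = a * Poly_Mapping.lookup c xs"
  by (simp add: scale_def Poly_Mapping.map.rep_eq when_def)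

lemma scale_zero_right [simp]: "scale a 0 = 0"
  by (rule poly_mapping_eqI) simp

lemma scale_zero_left [simp]: "scale 0 c = 0"
  by (rule poly_mapping_eqI) simp

lemma scale_one [simp]: "scale 1 c = c"
  by (rule poly_mapping_eqI) simp

lemma scale_add_right: "scale a (c + d) = scale a c + scale a d"
  by (rule poly_mapping_eqI) (simp add: lookup_add distrib_left)

lemma scale_add_left: "scale (a + b) c = scale a c + scale b c"
  by (rule poly_mapping_eqI) (simp add: lookup_add distrib_right)

lemma scale_diff_right: "scale a (c - d) = scale a c - scale a d"
  by (rule poly_mapping_eqI) (simp add: lookup_minus right_diff_distrib)

lemma scale_scale: "scale a (scale b c) = scale (a * b) c"
  by (rule poly_mapping_eqI) (simp add: mult.assoc)

lemma scale_minus_left: "scale (- a) c = - scale a c"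
  by (rule poly_mapping_eqI) simp

lemma scale_sum: "scale a (\<Sum>i\<in>A. c i) = (\<Sum>i\<in>A. scale a (c i))"
  by (induction A rule: infinite_finite_induct) (simp_all add: scale_add_right)

lemma keys_scale: "Poly_Mapping.keys (scale a c) \<subseteq> Poly_Mapping.keys c"
  by (auto simp: in_keys_iff)

text \<open>Terms outside the support are scaled by 0, so chains with different supports can be
  summed over one index set.\<close>

lemma lin_ext_superset:
  assumes "finite A" and "Poly_Mapping.keys c \<subseteq> A"
  shows "lin_ext \<phi> c = (\<Sum>xs\<in>A. scale (Poly_Mapping.lookup c xs) (\<phi> xs))"
  unfolding lin_ext_def using assms
  by (intro sum.mono_neutral_left) (auto simp: in_keys_iff)

lemma lin_ext_zero [simp]: "lin_ext \<phi> 0 = 0"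
  by (simp add: lin_ext_def)

lemma lin_ext_add: "lin_ext \<phi> (c + d) = lin_ext \<phi> c + lin_ext \<phi> d"
proof -
  \<comment> \<open>Cancellation can make the support of \<open>c + d\<close> smaller than this
    union, never larger.\<close>
  let ?A = "Poly_Mapping.keys c \<union> Poly_Mapping.keys d"
  have "lin_ext \<phi> e = (\<Sum>xs\<in>?A. scale (Poly_Mapping.lookup e xs) (\<phi> xs))"
    if "e \<in> {c, d, c + d}" for e
    using that keys_add[of c d] by (intro lin_ext_superset) auto
  then show ?thesis
    by (simp add: lookup_add scale_add_left sum.distrib)
qed

lemma lin_ext_scale: "lin_ext \<phi> (scale a c) = scale a (lin_ext \<phi> c)"
  using lin_ext_superset[OF finite_keys keys_scale, of \<phi> a c]
  by (simp add: lin_ext_def scale_sum scale_scale)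

lemma lin_ext_minus: "lin_ext \<phi> (- c) = - lin_ext \<phi> c"
  using lin_ext_add[of \<phi> c "- c"] by (simp add: eq_neg_iff_add_eq_0 add.commute)

lemma lin_ext_diff: "lin_ext \<phi> (c - d) = lin_ext \<phi> c - lin_ext \<phi> d"
  using lin_ext_add[of \<phi> c "- d"] by (simp add: lin_ext_minus)

lemma lin_ext_sum: "lin_ext \<phi> (\<Sum>i\<in>A. c i) = (\<Sum>i\<in>A. lin_ext \<phi> (c i))"
  by (induction A rule: infinite_finite_induct) (simp_all add: lin_ext_add)

lemma lin_ext_cong:
  "(\<And>xs. xs \<in> Poly_Mapping.keys c \<Longrightarrow> \<phi> xs = \<psi> xs) \<Longrightarrow> lin_ext \<phi> c = lin_ext \<psi> c"
  by (simp add: lin_ext_def)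

lemma lin_ext_lin_ext: "lin_ext \<phi> (lin_ext \<psi> c) = lin_ext (\<lambda>xs. lin_ext \<phi> (\<psi> xs)) c"
  by (simp add: lin_ext_def[of \<psi>] lin_ext_def[of "\<lambda>xs. lin_ext \<phi> (\<psi> xs)"] lin_ext_sum lin_ext_scale)

lemma lin_ext_add_fun: "lin_ext (\<lambda>xs. \<phi> xs + \<psi> xs) c = lin_ext \<phi> c + lin_ext \<psi> c"
  by (simp add: lin_ext_def scale_add_right sum.distrib)

lemma lin_ext_diff_fun: "lin_ext (\<lambda>xs. \<phi> xs - \<psi> xs) c = lin_ext \<phi> c - lin_ext \<psi> c"
  by (simp add: lin_ext_def scale_diff_right sum_subtractf)

lemma tup_degenerate: "\<not> distinct_adj xs \<Longrightarrow> tup xs = 0"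
  by (simp add: tup_def)

text \<open>The hypothesis says that a formula on tuples respects the omission of degenerate ones;
  evaluation at \<open>tup xs\<close> then requires no case split.\<close>

lemma lin_ext_tup:
  assumes "\<not> distinct_adj xs \<Longrightarrow> \<phi> xs = 0"
  shows "lin_ext \<phi> (tup xs) = \<phi> xs"
proof (cases "distinct_adj xs")
  case True
  \<comment> \<open>\<open>{xs}\<close> is taken as a superset of the support, which is empty in the
    zero ring.\<close>
  have "lin_ext \<phi> (Poly_Mapping.single xs 1) =
      (\<Sum>ys\<in>{xs}. scale (Poly_Mapping.lookup (Poly_Mapping.single xs 1) ys) (\<phi> ys))"
    by (rule lin_ext_superset) auto
  with True show ?thesis
    by (simp add: tup_def)
next
  case False
  with assms show ?thesis
    by (simp add: tup_degenerate)
qed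

section \<open>The augmented complex\<close>

text \<open>No path from \<open>x\<close> to the next entry is asked for, so a cone may leave the
  reachability complex. The identities are proved among all tuples and restricted
  afterwards.\<close>

definition cone :: "'v \<Rightarrow> ('v, 'r::{comm_ring, comm_monoid_mult}) chain \<Rightarrow> ('v, 'r) chain" where
  "cone x = lin_ext (\<lambda>ys. tup (x # ys))"

lemma cone_tup [simp]: "cone x (tup ys) = tup (x # ys)"
  unfolding cone_def by (rule lin_ext_tup) (auto intro!: tup_degenerate simp: distinct_adj_Cons)

lemma cone_zero [simp]: "cone x 0 = 0"
  by (simp add: cone_def)

lemma cone_cone [simp]: "cone x (cone x c) = 0"
proof -
  have "cone x (cone x c) = lin_ext (\<lambda>ys. cone x (tup (x # ys))) c"
    by (simp add: cone_def lin_ext_lin_ext)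
  then show ?thesis
    by (simp add: tup_degenerate) (simp add: lin_ext_def)
qed

lemmas cone_linear =
  lin_ext_add[where \<phi> = "\<lambda>ys. tup (x # ys)" for x, folded cone_def]
  lin_ext_diff[where \<phi> = "\<lambda>ys. tup (x # ys)" for x, folded cone_def]
  lin_ext_minus[where \<phi> = "\<lambda>ys. tup (x # ys)" for x, folded cone_def]

text \<open>Equal neighbours have equal images, so degenerate tuples stay degenerate.\<close>

lemma induced_tup [simp]: "induced f (tup xs) = tup (map f xs)"
  unfolding induced_def
  by (rule lin_ext_tup) (use distinct_adj_mapD tup_degenerate in blast)

lemma induced_cone: "induced f (cone x c) = cone (f x) (induced f c)"
proof -
  have "induced f (cone x c) = lin_ext (\<lambda>ys. induced f (tup (x # ys))) c"
    by (simp add: cone_def induced_def lin_ext_lin_ext)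
  also have "\<dots> = lin_ext (\<lambda>ys. cone (f x) (tup (map f ys))) c"
    by simp
  also have "\<dots> = cone (f x) (induced f c)"
    unfolding cone_def[of "f x"] induced_def lin_ext_lin_ext ..
  finally show ?thesis .
qed

lemma induced_diff: "induced f (c - d) = induced f c - induced f d"
  by (simp add: induced_def lin_ext_diff)

lemma induced_comp: "induced f (induced g c) = induced (f \<circ> g) c"
proof -
  have "induced f (induced g c) = lin_ext (\<lambda>xs. induced f (tup (map g xs))) c"
    by (simp add: induced_def[of g] induced_def[of f] lin_ext_lin_ext)
  then show ?thesis
    by (simp add: induced_def[of "f \<circ> g"])
qed

section \<open>The augmented differential\<close>

definition face_sum :: "'v list \<Rightarrow> ('v, 'r::{comm_ring, comm_monoid_mult}) chain" where
  "face_sum xs = (\<Sum>j<length xs. scale ((- 1) ^ j) (tup (take j xs @ drop (Suc j) xs)))"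

text \<open>This is augmented because \<open>face_sum [x]\<close> is \<open>tup []\<close>, the
  generator in degree -1.\<close>

definition aug_boundary ::
  "('v, 'r::{comm_ring, comm_monoid_mult}) chain \<Rightarrow> ('v, 'r) chain" where
  "aug_boundary = lin_ext face_sum"

lemma face_sum_Nil [simp]: "face_sum [] = 0"
  by (simp add: face_sum_def)

text \<open>The face \<open>j = 0\<close> deletes \<open>x\<close>; all others keep it, and the
  index shift by one produces the minus sign.\<close>

lemma face_sum_Cons:
  "(face_sum (x # xs) :: ('v, 'r::{comm_ring, comm_monoid_mult}) chain) =
     tup xs - cone x (face_sum xs)"
proof -
  have "cone x (face_sum xs :: ('v, 'r) chain) =
      (\<Sum>j<length xs. scale ((- 1) ^ j) (tup (x # take j xs @ drop (Suc j) xs)))"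
    unfolding face_sum_def cone_def lin_ext_sum lin_ext_scale
    \<comment> \<open>Unfolding exposes the linearity of \<open>lin_ext\<close>; folding back lets
      \<open>cone_tup\<close> act on each face.\<close>
    by (simp flip: cone_def)
  then show ?thesis
    unfolding face_sum_def[of "x # xs"]
    by (simp add: sum.lessThan_Suc_shift scale_minus_left sum_negf del: sum.lessThan_Suc)
qed

text \<open>The faces deleting one or the other of two equal neighbours cancel, and every other face
  stays degenerate.\<close>

lemma face_sum_degenerate: "\<not> distinct_adj xs \<Longrightarrow> face_sum xs = 0"
proof (induction xs)
  case (Cons x xs)
  show ?case
  proof (cases "distinct_adj xs")
    case True
    \<comment> \<open>The repetition sits at the front, so two copies of \<open>tup xs\<close>
      cancel and a double cone remains.\<close>
    with Cons.prems obtain ys where "xs = x # ys"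
      by (cases xs) (auto simp: distinct_adj_Cons)
    then show ?thesis
      by (simp add: face_sum_Cons cone_linear)
  next
    case False
    with Cons.IH show ?thesis
      by (simp add: face_sum_Cons tup_degenerate)
  qed
qed simp

lemma aug_boundary_tup [simp]: "aug_boundary (tup xs) = face_sum xs"
  unfolding aug_boundary_def by (rule lin_ext_tup) (rule face_sum_degenerate)

text \<open>\<open>induced id\<close> omits the degenerate tuples of a chain; the identity holds for all chains.\<close>

lemma aug_boundary_cone: "aug_boundary (cone x c) = induced id c - cone x (aug_boundary c)"
proof -
  have "aug_boundary (cone x c) = lin_ext (\<lambda>ys. aug_boundary (tup (x # ys))) c"
    by (simp add: cone_def aug_boundary_def lin_ext_lin_ext)
  also have "\<dots> = lin_ext (\<lambda>ys. tup ys - cone x (face_sum ys)) c"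
    by (simp add: face_sum_Cons)
  also have "\<dots> = induced id c - cone x (aug_boundary c)"
    unfolding lin_ext_diff_fun by (simp add: induced_def cone_def aug_boundary_def lin_ext_lin_ext)
  finally show ?thesis .
qed

lemma aug_boundary_diff: "aug_boundary (c - d) = aug_boundary c - aug_boundary d"
  by (simp add: aug_boundary_def lin_ext_diff)

lemma aug_boundary_minus: "aug_boundary (- c) = - aug_boundary c"
  by (simp add: aug_boundary_def lin_ext_minus)

text \<open>The recursion for \<open>face_sum\<close> is preserved because \<open>induced f\<close>
  commutes with cones; the last call settles \<open>induced f 0 = 0\<close> for the empty
  list.\<close>

lemma induced_face_sum: "induced f (face_sum xs) = face_sum (map f xs)"
  by (induction xs) (simp_all add: face_sum_Cons induced_diff induced_cone, simp add: induced_def)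

lemma aug_boundary_induced: "aug_boundary (induced f c) = induced f (aug_boundary c)"
proof -
  have "aug_boundary (induced f c) = lin_ext (\<lambda>xs. aug_boundary (tup (map f xs))) c"
    by (simp add: induced_def aug_boundary_def lin_ext_lin_ext)
  also have "\<dots> = lin_ext (\<lambda>xs. induced f (face_sum xs)) c"
    by (simp add: induced_face_sum)
  also have "\<dots> = induced f (aug_boundary c)"
    by (simp add: induced_def aug_boundary_def lin_ext_lin_ext)
  finally show ?thesis .
qed

section \<open>The prism operator\<close>

definition prism_sum ::
  "('a \<Rightarrow> 'b) \<Rightarrow> ('a \<Rightarrow> 'b) \<Rightarrow> 'a list \<Rightarrow> ('b, 'r::{comm_ring, comm_monoid_mult}) chain" where
  "prism_sum f g xs =
     (\<Sum>j<length xs. scale ((- 1) ^ (j + 1)) (tup (map f (take (Suc j) xs) @ map g (drop j xs))))"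

lemma homotopy_op_eq: "homotopy_op f g = lin_ext (prism_sum f g)"
  by (simp add: homotopy_op_def prism_sum_def[abs_def])

lemma prism_sum_Nil [simp]: "prism_sum f g [] = 0"
  by (simp add: prism_sum_def)

text \<open>The summand \<open>j = 0\<close> crosses from \<open>f\<close> to \<open>g\<close>
  already at \<open>x\<close>; the others start with \<open>f x\<close> and continue with a prism
  term of \<open>xs\<close>, with the sign flipped by the index shift.\<close>

lemma prism_sum_Cons:
  fixes f g :: "'a \<Rightarrow> 'b"
  shows "(prism_sum f g (x # xs) :: ('b, 'r::{comm_ring, comm_monoid_mult}) chain) =
     - tup (f x # g x # map g xs) - cone (f x) (prism_sum f g xs)"
proof -
  have "cone (f x) (prism_sum f g xs :: ('b, 'r) chain) =
      (\<Sum>j<length xs. scale ((- 1) ^ (j + 1))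
         (tup (f x # map f (take (Suc j) xs) @ map g (drop j xs))))"
    unfolding prism_sum_def cone_def lin_ext_sum lin_ext_scale
    by (simp flip: cone_def)
  then show ?thesis
    unfolding prism_sum_def[of f g "x # xs"]
    by (simp add: sum.lessThan_Suc_shift scale_minus_left sum_negf del: sum.lessThan_Suc)
qed

text \<open>Unlike for faces nothing has to cancel: each summand contains both equal neighbours
  under \<open>f\<close> or both under \<open>g\<close>.\<close>

lemma prism_sum_degenerate: "\<not> distinct_adj xs \<Longrightarrow> prism_sum f g xs = 0"
proof (induction xs)
  case (Cons x xs)
  show ?case
  proof (cases "distinct_adj xs")
    case True
    with Cons.prems obtain ys where "xs = x # ys"
      by (cases xs) (auto simp: distinct_adj_Cons)
    then show ?thesis
      by (simp add: prism_sum_Cons cone_linear tup_degenerate)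
  next
    case False
    then have "tup (f x # g x # map g xs) = 0"
      by (intro tup_degenerate) (auto simp: distinct_adj_Cons dest: distinct_adj_mapD)
    with False Cons.IH show ?thesis
      by (simp add: prism_sum_Cons)
  qed
qed simp

lemma homotopy_op_tup [simp]: "homotopy_op f g (tup xs) = prism_sum f g xs"
  unfolding homotopy_op_eq by (rule lin_ext_tup) (rule prism_sum_degenerate)

lemma homotopy_op_diff: "homotopy_op f g (c - d) = homotopy_op f g c - homotopy_op f g d"
  by (simp add: homotopy_op_eq lin_ext_diff)

lemma homotopy_op_cone:
  "homotopy_op f g (cone x c) =
     - cone (f x) (cone (g x) (induced g c)) - cone (f x) (homotopy_op f g c)"
proof -
  have "homotopy_op f g (cone x c) = lin_ext (\<lambda>ys. homotopy_op f g (tup (x # ys))) c"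
    by (simp add: cone_def homotopy_op_eq lin_ext_lin_ext)
  \<comment> \<open>Writing \<open>0 -\<close> for the unary minus lets
    \<open>lin_ext_diff_fun\<close> split off every term.\<close>
  also have "\<dots> = lin_ext (\<lambda>ys. 0 - cone (f x) (cone (g x) (tup (map g ys))) -
      cone (f x) (prism_sum f g ys)) c"
    by (simp add: prism_sum_Cons)
  also have "\<dots> = - cone (f x) (cone (g x) (induced g c)) - cone (f x) (homotopy_op f g c)"
    unfolding lin_ext_diff_fun
    by (simp add: induced_def cone_def homotopy_op_eq lin_ext_lin_ext) (simp add: lin_ext_def)
  finally show ?thesis .
qed

text \<open>This removes the \<open>induced id\<close> that \<open>aug_boundary_cone\<close>
  introduces: a combination of values of \<open>tup\<close> has no degenerate terms left.\<close>

lemma induced_id_prism_sum: "induced id (prism_sum f g xs) = prism_sum f g xs"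
proof -
  have tup: "lin_ext (\<lambda>xs. tup (map id xs)) (tup ys) = tup ys" for ys
    using induced_tup[of id ys] by (simp add: induced_def)
  show ?thesis
    unfolding prism_sum_def induced_def lin_ext_sum lin_ext_scale tup ..
qed

lemma prism_identity:
  fixes f g :: "'a \<Rightarrow> 'b"
  shows "aug_boundary (prism_sum f g xs) + homotopy_op f g (face_sum xs) =
     (tup (map f xs) - tup (map g xs) :: ('b, 'r::{comm_ring, comm_monoid_mult}) chain)"
proof (induction xs)
  case Nil
  then show ?case
    by (simp add: aug_boundary_def homotopy_op_eq)
next
  case (Cons x xs)
  \<comment> \<open>The first two terms are the faces of \<open>(f x, g x, ...)\<close> without
    \<open>f x\<close> and without \<open>g x\<close>.\<close>
  have 1: "(aug_boundary (prism_sum f g (x # xs)) :: ('b, 'r) chain) =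
      - tup (g x # map g xs) + cone (f x) (tup (map g xs))
      - cone (f x) (cone (g x) (face_sum (map g xs)))
      - prism_sum f g xs + cone (f x) (aug_boundary (prism_sum f g xs))"
    by (simp add: prism_sum_Cons face_sum_Cons aug_boundary_diff aug_boundary_minus
        aug_boundary_cone induced_id_prism_sum cone_linear)
  \<comment> \<open>The first two terms here cancel the prism sum and the double cone in
    \<open>1\<close>.\<close>
  have 2: "(homotopy_op f g (face_sum (x # xs)) :: ('b, 'r) chain) =
      prism_sum f g xs + cone (f x) (cone (g x) (face_sum (map g xs)))
      + cone (f x) (homotopy_op f g (face_sum xs))"
    by (simp add: face_sum_Cons homotopy_op_diff homotopy_op_cone induced_face_sum)
  \<comment> \<open>What survives is arranged so that the induction hypothesis turns the argument of
    the cone into \<open>tup (map f xs)\<close>.\<close>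
  have "aug_boundary (prism_sum f g (x # xs)) + homotopy_op f g (face_sum (x # xs)) =
      (- tup (map g (x # xs)) + cone (f x) (tup (map g xs) +
        (aug_boundary (prism_sum f g xs) + homotopy_op f g (face_sum xs))) :: ('b, 'r) chain)"
    unfolding 1 2 by (simp add: cone_linear)
  then show ?case
    unfolding Cons.IH by simp
qed

text \<open>Both sides are linear, so the identity on tuples suffices.\<close>

lemma aug_homotopy:
  "aug_boundary (homotopy_op f g c) + homotopy_op f g (aug_boundary c) =
     induced f c - induced g c"
proof -
  have "aug_boundary (homotopy_op f g c) + homotopy_op f g (aug_boundary c) =
      lin_ext (\<lambda>xs. aug_boundary (prism_sum f g xs) + homotopy_op f g (face_sum xs)) c"
    by (simp add: aug_boundary_def homotopy_op_eq lin_ext_lin_ext lin_ext_add_fun)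
  then show ?thesis
    by (simp add: prism_identity lin_ext_diff_fun induced_def)
qed

section \<open>The reachability complex\<close>

lemma has_path_trans:
  assumes "has_path G u v" and "has_path G v w"
  shows "has_path G u w"
proof -
  obtain p q where "directed_path G u p v" and "directed_path G v q w"
    using assms by (auto simp: has_path_def)
  \<comment> \<open>The vertex \<open>v\<close> occurs twice in a row in \<open>p @ q\<close>; paths
    may stand still.\<close>
  then have "directed_path G u (p @ q) w"
    by (auto simp: directed_path_def successively_append_iff)
  then show ?thesis
    by (auto simp: has_path_def)
qed

text \<open>By transitivity every entry reaches all later ones; in this form the property passes
  directly to \<open>take\<close> and \<open>drop\<close>.\<close>

lemma successively_has_path: "successively (has_path G) = sorted_wrt (has_path G)"
  by (intro ext successively_conv_sorted_wrt) (auto intro: transpI has_path_trans)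

lemma has_path_map:
  assumes "digraph_map G H f" and "has_path G u v"
  shows "has_path H (f u) (f v)"
proof -
  obtain p where p: "directed_path G u p v"
    using assms by (auto simp: has_path_def)
  \<comment> \<open>An edge collapsed by \<open>f\<close> becomes a stationary step of the image
    path.\<close>
  then have "successively (\<lambda>x y. f x = f y \<or> (f x, f y) \<in> parcs H) p"
    using assms(1) unfolding directed_path_def digraph_map_def
    by (auto elim!: successively_mono)
  with p assms(1) have "directed_path H (f u) (map f p) (f v)"
    unfolding directed_path_def digraph_map_def
    by (auto simp: successively_map hd_map last_map)
  then show ?thesis
    by (auto simp: has_path_def)
qed

lemma successively_has_path_map:
  assumes "digraph_map G H f" and "successively (has_path G) xs"
  shows "successively (has_path H) (map f xs)"
  using assms(2) has_path_map[OF assms(1)] by (auto simp: successively_map elim: successively_mono)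

section \<open>Membership in the reachability complex\<close>

lemma RC_zero [simp]: "0 \<in> RC G k"
  by (simp add: RC_def)

lemma RC_add: "c \<in> RC G k \<Longrightarrow> d \<in> RC G k \<Longrightarrow> c + d \<in> RC G k"
  using keys_add[of c d] by (auto simp: RC_def)

lemma RC_diff: "c \<in> RC G k \<Longrightarrow> d \<in> RC G k \<Longrightarrow> c - d \<in> RC G k"
  using keys_diff[of c d] by (auto simp: RC_def)

lemma RC_scale: "c \<in> RC G k \<Longrightarrow> scale a c \<in> RC G k"
  using keys_scale[of a c] by (auto simp: RC_def)

lemma RC_sum: "(\<And>i. i \<in> A \<Longrightarrow> c i \<in> RC G k) \<Longrightarrow> (\<Sum>i\<in>A. c i) \<in> RC G k"
  by (induction A rule: infinite_finite_induct) (simp_all add: RC_add)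

lemma RC_lin_ext:
  assumes "c \<in> RC G k" and "\<And>xs. xs \<in> rc_gens G k \<Longrightarrow> \<phi> xs \<in> RC H m"
  shows "lin_ext \<phi> c \<in> RC H m"
  using assms unfolding lin_ext_def RC_def[of G] by (intro RC_sum RC_scale) auto

text \<open>A degenerate tuple becomes 0, which lies in \<open>RC G k\<close> as well.\<close>

lemma RC_tup:
  assumes "length xs = Suc k" and "set xs \<subseteq> pverts G" and "successively (has_path G) xs"
  shows "tup xs \<in> RC G k"
  using assms by (auto simp: tup_def RC_def rc_gens_def)

lemma RC_induced:
  assumes "digraph_map G H f" and "c \<in> RC G k"
  shows "induced f c \<in> RC H k"
  unfolding induced_def
proof (rule RC_lin_ext[OF assms(2)])
  fix xs assume xs: "xs \<in> rc_gens G k"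
  then have "successively (has_path H) (map f xs)"
    using successively_has_path_map[OF assms(1)] by (simp add: rc_gens_def)
  with xs assms(1) show "tup (map f xs) \<in> RC H k"
    by (intro RC_tup) (auto simp: rc_gens_def digraph_map_def)
qed

lemma RC_homotopy_op:
  assumes "long_homotopy G H f g" and "c \<in> RC G k"
  shows "homotopy_op f g c \<in> RC H (Suc k)"
  unfolding homotopy_op_def
proof (intro RC_lin_ext[OF assms(2)] RC_sum RC_scale RC_tup)
  fix xs j assume xs: "xs \<in> rc_gens G k" and "j \<in> {..<length xs}"
  then have j: "j < length xs"
    by simp
  let ?ys = "map f (take (Suc j) xs) @ map g (drop j xs)"
  \<comment> \<open>The two pieces overlap in entry \<open>j\<close>, which raises the degree by
    one.\<close>
  show "length ?ys = Suc (Suc k)"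
    using xs j by (auto simp: rc_gens_def)
  have f: "digraph_map G H f" and g: "digraph_map G H g"
    using assms(1) by (auto simp: long_homotopy_def)
  have "set xs \<subseteq> pverts G"
    using xs by (simp add: rc_gens_def)
  then show "set ?ys \<subseteq> pverts H"
    using f g by (auto simp: digraph_map_def image_subset_iff dest!: in_set_takeD in_set_dropD)
  have sorted: "sorted_wrt (has_path G) xs"
    using xs by (simp add: rc_gens_def successively_has_path)
  have "successively (has_path H) (map f (take (Suc j) xs))"
    using sorted_wrt_take[OF sorted]
    by (intro successively_has_path_map[OF f]) (simp add: successively_has_path)
  moreover have "successively (has_path H) (map g (drop j xs))"
    using sorted_wrt_drop[OF sorted]
    by (intro successively_has_path_map[OF g]) (simp add: successively_has_path)
  \<comment> \<open>The paths of the long homotopy enter here, at the junction of the two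
    pieces.\<close>
  moreover have "has_path H (f (xs ! j)) (g (xs ! j))"
    using assms(1) \<open>set xs \<subseteq> pverts G\<close> nth_mem[OF j] unfolding long_homotopy_def by blast
  ultimately show "successively (has_path H) ?ys"
    using j by (simp add: successively_append_iff successively_Cons last_map hd_map hd_drop_conv_nth
        take_Suc_conv_app_nth)
qed

section \<open>From the augmented differential to the actual one\<close>

lemma boundary_eq: "boundary = lin_ext (\<lambda>xs. if length xs \<le> 1 then 0 else face_sum xs)"
  by (simp only: boundary_def face_sum_def)

lemma boundary_zero [simp]: "boundary 0 = 0"
  by (simp add: boundary_eq)

lemma boundary_add: "boundary (c + d) = boundary c + boundary d"
  by (simp add: boundary_eq lin_ext_add)

lemma boundary_diff: "boundary (c - d) = boundary c - boundary d"
  by (simp add: boundary_eq lin_ext_diff)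

lemma boundary_scale: "boundary (scale a c) = scale a (boundary c)"
  by (simp add: boundary_eq lin_ext_scale)

lemma boundary_RC_0: "c \<in> RC G 0 \<Longrightarrow> boundary c = 0"
  unfolding boundary_eq lin_ext_def by (rule sum.neutral) (auto simp: RC_def rc_gens_def)

text \<open>In positive degree all tuples have length at least two, where both differentials agree;
  the augmented identities transfer through this.\<close>

lemma boundary_RC_Suc: "c \<in> RC G (Suc k) \<Longrightarrow> boundary c = aug_boundary c"
  unfolding boundary_eq aug_boundary_def
  by (rule lin_ext_cong) (auto simp: RC_def rc_gens_def)

lemma linear_between_lin_ext:
  assumes "\<And>c. c \<in> RC G k \<Longrightarrow> lin_ext \<phi> c \<in> RC H m"
  shows "linear_between (RC G k) (RC H m) (lin_ext \<phi>)"
  using assms by (auto simp: linear_between_def lin_ext_add lin_ext_scale)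

lemma rc_chain_map_induced:
  assumes "digraph_map G H f"
  shows "rc_chain_map G H (induced f)"
  unfolding rc_chain_map_def
proof (intro allI conjI ballI)
  fix k
  show "linear_between (RC G k) (RC H k) (induced f)"
    using RC_induced[OF assms] unfolding induced_def by (rule linear_between_lin_ext)
  fix c :: "('a, 'c) chain" assume c: "c \<in> RC G k"
  show "boundary (induced f c) = induced f (boundary c)"
  proof (cases k)
    case 0
    then show ?thesis
      using c RC_induced[OF assms c] by (simp add: boundary_RC_0) (simp add: induced_def)
  next
    case (Suc m)
    then show ?thesis
      using c RC_induced[OF assms c] by (simp add: boundary_RC_Suc aug_boundary_induced)
  qed
qed

text \<open>In degree 0 the differentials differ by multiples of the empty tuple, and these are
  killed by \<open>homotopy_op\<close> since its sum is then empty.\<close>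

lemma homotopy_op_boundary:
  assumes "c \<in> RC G k"
  shows "homotopy_op f g (boundary c) = homotopy_op f g (aug_boundary c)"
proof (cases k)
  case 0
  have "homotopy_op f g (aug_boundary c) = lin_ext (\<lambda>xs. homotopy_op f g (face_sum xs)) c"
    by (simp add: homotopy_op_eq aug_boundary_def lin_ext_lin_ext)
  also have "\<dots> = 0"
    unfolding lin_ext_def
  proof (rule sum.neutral, rule ballI)
    fix xs assume "xs \<in> Poly_Mapping.keys c"
    with 0 assms obtain x where "xs = [x]"
      by (auto simp: RC_def rc_gens_def length_Suc_conv)
    then show "scale (Poly_Mapping.lookup c xs) (homotopy_op f g (face_sum xs)) = 0"
      by (simp add: face_sum_Cons)
  qed
  finally show ?thesis
    using 0 assms by (simp add: boundary_RC_0) (simp add: homotopy_op_eq)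
next
  case (Suc m)
  with assms show ?thesis
    by (simp add: boundary_RC_Suc)
qed

lemma rc_chain_homotopy_homotopy_op:
  assumes "long_homotopy G H f g"
  shows "rc_chain_homotopy G H (induced f) (induced g) (homotopy_op f g)"
  unfolding rc_chain_homotopy_def
proof (intro conjI allI ballI)
  show "rc_chain_map G H (induced f)" and "rc_chain_map G H (induced g)"
    using assms by (auto simp: long_homotopy_def intro: rc_chain_map_induced)
  fix k
  show "linear_between (RC G k) (RC H (Suc k)) (homotopy_op f g)"
    using RC_homotopy_op[OF assms] unfolding homotopy_op_eq by (rule linear_between_lin_ext)
  fix c :: "('a, 'c) chain" assume c: "c \<in> RC G k"
  show "boundary (homotopy_op f g c) + homotopy_op f g (boundary c) = induced f c - induced g c"
    \<comment> \<open>The chain \<open>homotopy_op f g c\<close> has positive degree for every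
      \<open>k\<close>, so degree 0 needs no separate case.\<close>
    by (simp add: boundary_RC_Suc[OF RC_homotopy_op[OF assms c]] homotopy_op_boundary[OF c]
        aug_homotopy)
qed

section \<open>Reachability homology\<close>

lemma cycles_RC: "x \<in> rc_cycles G k \<Longrightarrow> x \<in> RC G k"
  by (simp add: rc_cycles_def)

lemma cycles_add: "x \<in> rc_cycles G k \<Longrightarrow> y \<in> rc_cycles G k \<Longrightarrow> x + y \<in> rc_cycles G k"
  by (simp add: rc_cycles_def RC_add boundary_add)

lemma cycles_scale: "x \<in> rc_cycles G k \<Longrightarrow> scale a x \<in> rc_cycles G k"
  by (simp add: rc_cycles_def RC_scale boundary_scale)

lemma boundaries_zero: "0 \<in> rc_boundaries G k"
  unfolding rc_boundaries_def by (rule image_eqI[of _ _ 0]) simp_all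

lemma boundaries_add:
  "x \<in> rc_boundaries G k \<Longrightarrow> y \<in> rc_boundaries G k \<Longrightarrow> x + y \<in> rc_boundaries G k"
  unfolding rc_boundaries_def by (auto simp: RC_add simp flip: boundary_add)

lemma boundaries_diff:
  "x \<in> rc_boundaries G k \<Longrightarrow> y \<in> rc_boundaries G k \<Longrightarrow> x - y \<in> rc_boundaries G k"
  unfolding rc_boundaries_def by (auto simp: RC_diff simp flip: boundary_diff)

lemma boundaries_scale: "x \<in> rc_boundaries G k \<Longrightarrow> scale a x \<in> rc_boundaries G k"
  unfolding rc_boundaries_def by (auto simp: RC_scale simp flip: boundary_scale)

text \<open>The three properties reflect that boundaries contain 0 and are closed under negation and
  addition.\<close>

lemma equiv_homologous:
  fixes G :: "'a pair_pre_digraph"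
  shows "equiv (rc_cycles G k)
    (homologous G k :: ('a, 'b::{comm_ring, comm_monoid_mult}) chain rel)"
    (is "equiv ?Z ?R")
proof (rule equivI)
  show "?R \<subseteq> ?Z \<times> ?Z"
    by (auto simp: homologous_def)
  show "refl_on ?Z ?R"
    by (rule refl_onI) (auto simp: homologous_def boundaries_zero)
  show "sym ?R"
  proof (rule symI)
    fix x y :: "('a, 'b) chain" assume "(x, y) \<in> homologous G k"
    then show "(y, x) \<in> homologous G k"
      using boundaries_diff[OF boundaries_zero, of "x - y" G k] by (simp add: homologous_def)
  qed
  show "trans ?R"
  proof (rule transI)
    fix x y z :: "('a, 'b) chain"
    assume "(x, y) \<in> homologous G k" and "(y, z) \<in> homologous G k"
    then show "(x, z) \<in> homologous G k"
      using boundaries_add[of "x - y" G k "y - z"] by (simp add: homologous_def)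
  qed
qed

section \<open>Homology classes and operations on representatives\<close>

lemma RH_cases:
  assumes "X \<in> RH G k"
  obtains x where "x \<in> rc_cycles G k" and "X = homologous G k `` {x}"
  using assms by (auto simp: RH_def elim: quotientE)

lemma class_in_RH: "x \<in> rc_cycles G k \<Longrightarrow> homologous G k `` {x} \<in> RH G k"
  by (simp add: RH_def quotientI)

lemma class_eqI: "(x, y) \<in> homologous G k \<Longrightarrow> homologous G k `` {x} = homologous G k `` {y}"
  by (rule equiv_class_eq[OF equiv_homologous])

lemma homologous_refl: "x \<in> rc_cycles G k \<Longrightarrow> (x, x) \<in> homologous G k"
  by (simp add: homologous_def boundaries_zero)

text \<open>Changing representatives alters the sum by a boundary, so the union over all choices is
  a single class.\<close>

lemma rh_add_class:
  assumes "x \<in> rc_cycles G k" and "y \<in> rc_cycles G k"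
  shows "rh_add G k (homologous G k `` {x}) (homologous G k `` {y}) = homologous G k `` {x + y}"
proof -
  have "homologous G k `` {x' + y'} = homologous G k `` {x + y}"
    if "(x, x') \<in> homologous G k" and "(y, y') \<in> homologous G k" for x' y'
  proof (rule class_eqI[symmetric])
    show "(x + y, x' + y') \<in> homologous G k"
      using that boundaries_add[of "x - x'" G k "y - y'"]
      by (simp add: homologous_def cycles_add algebra_simps)
  qed
  \<comment> \<open>Reflexivity makes the union nonempty.\<close>
  with assms[THEN homologous_refl] show ?thesis
    unfolding rh_add_def by blast
qed

lemma rh_scale_class:
  assumes "x \<in> rc_cycles G k"
  shows "rh_scale G k a (homologous G k `` {x}) = homologous G k `` {scale a x}"
proof -
  have "homologous G k `` {scale a x'} = homologous G k `` {scale a x}"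
    if "(x, x') \<in> homologous G k" for x'
  proof (rule class_eqI[symmetric])
    show "(scale a x, scale a x') \<in> homologous G k"
      using that boundaries_scale[of "x - x'" G k a]
      by (simp add: homologous_def cycles_scale scale_diff_right)
  qed
  with assms[THEN homologous_refl] show ?thesis
    unfolding rh_scale_def by blast
qed

lemma rc_chain_map_RC: "rc_chain_map G H \<phi> \<Longrightarrow> x \<in> RC G k \<Longrightarrow> \<phi> x \<in> RC H k"
  unfolding rc_chain_map_def linear_between_def by blast

lemma rc_chain_map_boundary:
  "rc_chain_map G H \<phi> \<Longrightarrow> x \<in> RC G k \<Longrightarrow> boundary (\<phi> x) = \<phi> (boundary x)"
  by (auto simp: rc_chain_map_def)

lemma rc_chain_map_add:
  "rc_chain_map G H \<phi> \<Longrightarrow> x \<in> RC G k \<Longrightarrow> y \<in> RC G k \<Longrightarrow> \<phi> (x + y) = \<phi> x + \<phi> y"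
  by (auto simp: rc_chain_map_def linear_between_def)

lemma rc_chain_map_scale:
  "rc_chain_map G H \<phi> \<Longrightarrow> x \<in> RC G k \<Longrightarrow> \<phi> (scale a x) = scale a (\<phi> x)"
  by (auto simp: rc_chain_map_def linear_between_def)

lemma rc_chain_map_diff:
  assumes "rc_chain_map G H \<phi>" and "x \<in> RC G k" and "y \<in> RC G k"
  shows "\<phi> (x - y) = \<phi> x - \<phi> y"
  using rc_chain_map_add[OF assms(1) RC_diff[OF assms(2,3)] assms(3)] by (simp add: algebra_simps)

lemma rc_chain_map_cycles:
  assumes "rc_chain_map G H \<phi>" and "x \<in> rc_cycles G k"
  shows "\<phi> x \<in> rc_cycles H k"
proof -
  \<comment> \<open>Additivity gives \<open>\<phi> 0 = \<phi> 0 + \<phi> 0\<close>.\<close>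
  have "\<phi> 0 = 0"
    using rc_chain_map_add[OF assms(1) RC_zero RC_zero] by simp
  with assms show ?thesis
    by (auto simp: rc_cycles_def rc_chain_map_boundary intro: rc_chain_map_RC)
qed

text \<open>Representatives differing by \<open>boundary c\<close> have images differing by
  \<open>boundary (\<phi> c)\<close>, so the class is independent of the choice.\<close>

lemma rh_map_class:
  assumes "rc_chain_map G H \<phi>" and "x \<in> rc_cycles G k"
  shows "rh_map H k \<phi> (homologous G k `` {x}) = homologous H k `` {\<phi> x}"
proof -
  have "homologous H k `` {\<phi> x'} = homologous H k `` {\<phi> x}"
    if hom: "(x, x') \<in> homologous G k" for x'
  proof (rule class_eqI[symmetric])
    obtain c where c: "c \<in> RC G (Suc k)" and "x - x' = boundary c"
      using hom by (auto simp: homologous_def rc_boundaries_def)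
    moreover have "\<phi> x - \<phi> x' = \<phi> (x - x')"
      using hom rc_chain_map_diff[OF assms(1), of x k x'] by (simp add: homologous_def rc_cycles_def)
    ultimately have "\<phi> x - \<phi> x' = boundary (\<phi> c)"
      using rc_chain_map_boundary[OF assms(1) c] by simp
    then have "\<phi> x - \<phi> x' \<in> rc_boundaries H k"
      unfolding rc_boundaries_def using rc_chain_map_RC[OF assms(1) c] by blast
    with hom show "(\<phi> x, \<phi> x') \<in> homologous H k"
      using rc_chain_map_cycles[OF assms(1)] by (auto simp: homologous_def)
  qed
  with homologous_refl[OF assms(2)] show ?thesis
    unfolding rh_map_def by blast
qed

lemma rh_map_in_RH:
  assumes "rc_chain_map G H \<phi>" and "X \<in> RH G k"
  shows "rh_map H k \<phi> X \<in> RH H k"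
  using assms(2)
  by (rule RH_cases) (simp add: rh_map_class[OF assms(1)] class_in_RH rc_chain_map_cycles[OF assms(1)])

text \<open>On a cycle \<open>x\<close> the term \<open>s (boundary x)\<close> vanishes, so
  \<open>s x\<close> bounds the difference of the images.\<close>

lemma rh_map_chain_homotopy:
  assumes "rc_chain_homotopy G H \<phi> \<psi> s" and "X \<in> RH G k"
  shows "rh_map H k \<phi> X = rh_map H k \<psi> X"
proof -
  have maps: "rc_chain_map G H \<phi>" "rc_chain_map G H \<psi>"
    using assms(1) by (auto simp: rc_chain_homotopy_def)
  obtain x where x: "x \<in> rc_cycles G k" and X: "X = homologous G k `` {x}"
    using assms(2) by (rule RH_cases)
  have lin: "linear_between (RC G k) (RC H (Suc k)) s" for k
    using assms(1) by (simp add: rc_chain_homotopy_def)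
  have "s (0 + 0) = s 0 + s 0"
    using lin RC_zero unfolding linear_between_def by blast
  then have "s 0 = 0"
    by simp
  moreover have "boundary (s x) + s (boundary x) = \<phi> x - \<psi> x"
    using assms(1) x unfolding rc_chain_homotopy_def rc_cycles_def by blast
  ultimately have "\<phi> x - \<psi> x = boundary (s x)"
    using x by (simp add: rc_cycles_def)
  moreover have "s x \<in> RC H (Suc k)"
    using lin[of k] x by (auto simp: linear_between_def rc_cycles_def)
  ultimately have "(\<phi> x, \<psi> x) \<in> homologous H k"
    using maps[THEN rc_chain_map_cycles, OF x] by (simp add: homologous_def rc_boundaries_def)
  then show ?thesis
    unfolding X rh_map_class[OF maps(1) x] rh_map_class[OF maps(2) x] by (rule class_eqI)
qed

section \<open>Zig-zags and long-homotopy equivalences\<close>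

lemma rh_map_zigzag:
  assumes "long_homotopy_zigzag G H f g" and "X \<in> RH G k"
  shows "rh_map H k (induced f) X = rh_map H k (induced g) X"
  using assms(1) unfolding long_homotopy_zigzag_def
proof (induction rule: equivclp_induct)
  case (step h h')
  \<comment> \<open>The new link may point either way; equality of the maps on homology is
    symmetric.\<close>
  then show ?case
    using rh_map_chain_homotopy[OF rc_chain_homotopy_homotopy_op assms(2)] by metis
qed simp

lemma rh_map_induced_comp:
  assumes "digraph_map G H f" and "digraph_map H K g" and "X \<in> RH G k"
  shows "rh_map K k (induced g) (rh_map H k (induced f) X) = rh_map K k (induced (g \<circ> f)) X"
proof -
  obtain x where x: "x \<in> rc_cycles G k" and X: "X = homologous G k `` {x}"
    using assms(3) by (rule RH_cases)
  have comp: "digraph_map G K (g \<circ> f)"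
    using assms(1,2) by (fastforce simp: digraph_map_def)
  show ?thesis
    unfolding X using x assms(1,2) comp
    by (simp add: rh_map_class[OF rc_chain_map_induced] rc_chain_map_cycles[OF rc_chain_map_induced]
        induced_comp)
qed

text \<open>All tuples in the support are nondegenerate, so \<open>tup\<close> returns the basis
  element itself.\<close>

lemma induced_id:
  assumes "c \<in> RC G k"
  shows "induced id c = c"
proof -
  have "lin_ext (\<lambda>xs. tup (map id xs)) c =
      lin_ext (\<lambda>xs. Poly_Mapping.single xs 1) c"
    using assms by (intro lin_ext_cong) (auto simp: RC_def rc_gens_def tup_def)
  also have "\<dots> = c"
    by (rule poly_mapping_eqI)
      (simp add: lin_ext_def lookup_sum lookup_single when_def in_keys_iff if_distrib cong: if_cong)
  finally show ?thesis
    by (simp add: induced_def)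
qed

lemma rh_map_induced_id:
  assumes "X \<in> RH G k"
  shows "rh_map G k (induced id) X = X"
proof -
  obtain x where x: "x \<in> rc_cycles G k" and X: "X = homologous G k `` {x}"
    using assms by (rule RH_cases)
  have "digraph_map G G id"
    by (auto simp: digraph_map_def)
  then have "rh_map G k (induced id) X = homologous G k `` {induced id x}"
    unfolding X by (intro rh_map_class rc_chain_map_induced x)
  with x show ?thesis
    by (simp add: X rc_cycles_def induced_id[of x G k])
qed

text \<open>Linearity on homology is read off on representatives, where the chain map is
  linear.\<close>

lemma rh_iso_rh_map:
  fixes \<phi> :: "('a, 'r::{comm_ring, comm_monoid_mult}) chain \<Rightarrow> ('b, 'r) chain"
  assumes "rc_chain_map G H \<phi>" and "bij_betw (rh_map H k \<phi>) (RH G k) (RH H k)"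
  shows "rh_iso G H k (rh_map H k \<phi>)"
  unfolding rh_iso_def
proof (intro conjI ballI allI)
  note simps = rh_map_class[OF assms(1)] rc_chain_map_cycles[OF assms(1)] rh_add_class
    rh_scale_class cycles_add cycles_scale
  fix X :: "('a, 'r) chain set" assume "X \<in> RH G k"
  then obtain x where x: "x \<in> rc_cycles G k" and X: "X = homologous G k `` {x}"
    by (rule RH_cases)
  show "rh_map H k \<phi> (rh_scale G k a X) = rh_scale H k a (rh_map H k \<phi> X)" for a
    using x rc_chain_map_scale[OF assms(1) cycles_RC[OF x]] by (simp add: X simps)
  fix Y :: "('a, 'r) chain set" assume "Y \<in> RH G k"
  then obtain y where y: "y \<in> rc_cycles G k" and Y: "Y = homologous G k `` {y}"
    by (rule RH_cases)
  show "rh_map H k \<phi> (rh_add G k X Y) = rh_add H k (rh_map H k \<phi> X) (rh_map H k \<phi> Y)"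
    using x y rc_chain_map_add[OF assms(1) cycles_RC[OF x] cycles_RC[OF y]]
    by (simp add: X Y simps)
qed (rule assms(2))

text \<open>By functoriality and zig-zag invariance both composites with the map induced by
  \<open>g\<close> are the identity, so that map is the inverse.\<close>

lemma rh_iso_long_homotopy_equivalence:
  assumes "long_homotopy_equivalence G H f"
  shows "rh_iso G H k (rh_map H k (induced f))"
proof -
  obtain g where f: "digraph_map G H f" and g: "digraph_map H G g"
    and fg: "long_homotopy_zigzag H H (f \<circ> g) id" and gf: "long_homotopy_zigzag G G (g \<circ> f) id"
    using assms by (auto simp: long_homotopy_equivalence_def)
  show ?thesis
  proof (rule rh_iso_rh_map[OF rc_chain_map_induced[OF f]],
      rule bij_betw_byWitness[where f' = "rh_map G k (induced g)"])
    show "\<forall>X\<in>RH G k. rh_map G k (induced g) (rh_map H k (induced f) X) = X"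
      by (simp add: rh_map_induced_comp[OF f g] rh_map_zigzag[OF gf] rh_map_induced_id)
    show "\<forall>Y\<in>RH H k. rh_map H k (induced f) (rh_map G k (induced g) Y) = Y"
      by (simp add: rh_map_induced_comp[OF g f] rh_map_zigzag[OF fg] rh_map_induced_id)
  qed (use f g in \<open>auto intro: rh_map_in_RH rc_chain_map_induced\<close>)
qed

theorem theorem4p6:
  fixes G :: "'a pair_pre_digraph" and H :: "'b pair_pre_digraph"
    and f g :: "'a \<Rightarrow> 'b"
  assumes "pair_wf_digraph G" and "pair_wf_digraph H"
    and "digraph_map G H f" and "digraph_map G H g"
  shows
    "(long_homotopy G H f g \<longrightarrow>
        rc_chain_homotopic G H
          (induced f :: ('a, 'r::{comm_ring, comm_monoid_mult}) chain \<Rightarrow> ('b, 'r) chain)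
          (induced g) \<and>
        (\<forall>k. \<forall>X \<in> (RH G k :: ('a, 'r) chain set set).
           rh_map H k (induced f) X = rh_map H k (induced g) X) \<and>
        rc_chain_homotopy G H
          (induced f :: ('a, 'r) chain \<Rightarrow> ('b, 'r) chain) (induced g) (homotopy_op f g)) \<and>
     (long_homotopy_equivalence G H f \<longrightarrow>
        (\<forall>k. rh_iso G H k
           (rh_map H k (induced f :: ('a, 'r) chain \<Rightarrow> ('b, 'r) chain))))"
proof (intro conjI impI allI)
  assume "long_homotopy G H f g"
  then have homotopy: "rc_chain_homotopy G H
      (induced f :: ('a, 'r) chain \<Rightarrow> ('b, 'r) chain) (induced g) (homotopy_op f g)"
    by (rule rc_chain_homotopy_homotopy_op)
  then show "rc_chain_homotopy G H
      (induced f :: ('a, 'r) chain \<Rightarrow> ('b, 'r) chain) (induced g) (homotopy_op f g)" .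
  from homotopy show "rc_chain_homotopic G H
      (induced f :: ('a, 'r) chain \<Rightarrow> ('b, 'r) chain) (induced g)"
    by (auto simp: rc_chain_homotopic_def)
  from homotopy show "\<forall>X \<in> (RH G k :: ('a, 'r) chain set set).
      rh_map H k (induced f) X = rh_map H k (induced g) X" for k
    by (intro ballI rh_map_chain_homotopy)
qed (rule rh_iso_long_homotopy_equivalence)

end
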